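(* The sequence $\{G_k\}_{k\ge 1}$ of Erdős–Hajnal shift graphs is a Ramsey sequence. In particular, it is an ascending sequence with $\omega(G_k)=2$ for all $k$ and $\lim_{k\to\infty}\chi(G_k)=\infty$ that is a Ramsey sequence.
   Context: For a positive integer $k$, the Erdős–Hajnal shift graph $G_k$ has vertex set $\{[i,j] : i,j \text{ integers}, 1 \le i < j \le 2^k+1\}$, and two vertices $[i,j]$ and $[\ell,m]$ are adjacent if and only if $j=\ell$ or $m=i$. (These graphs are triangle-free, so $\omega(G_k)=2$, and $\chi(G_k)=k+1$.) A sequence of graphs $\{H_k\}$ is ascending if $H_k$ is isomorphic to a proper subgraph of $H_{k+1}$ for every positive integer $k$. An ascending sequence $\{H_k\}$ is a Ramsey sequence if for every positive integer $k$ there exists an integer $n>k$ such that every red-blue coloring of the edges of $H_n$ contains a monochromatic (all red or all blue) subgraph isomorphic to $H_k$. *)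

theory Defs
  imports Complex_Main
begin

record 'a sgraph =
  verts :: "'a set"
  edges :: "'a set set"

definition simple_graph :: "'a sgraph \<Rightarrow> bool" where
  "simple_graph G \<longleftrightarrow>
     finite (verts G) \<and> (\<forall>e \<in> edges G. e \<subseteq> verts G \<and> card e = 2)"

definition adjacent :: "'a sgraph \<Rightarrow> 'a \<Rightarrow> 'a \<Rightarrow> bool" where
  "adjacent G u v \<longleftrightarrow> {u, v} \<in> edges G"

definition subgraph :: "'a sgraph \<Rightarrow> 'a sgraph \<Rightarrow> bool" where
  "subgraph S G \<longleftrightarrow>
     simple_graph S \<and> simple_graph G \<and> verts S \<subseteq> verts G \<and> edges S \<subseteq> edges G"

definition proper_subgraph :: "'a sgraph \<Rightarrow> 'a sgraph \<Rightarrow> bool" where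
  "proper_subgraph S G \<longleftrightarrow> subgraph S G \<and> S \<noteq> G"

definition isomorphic :: "'a sgraph \<Rightarrow> 'b sgraph \<Rightarrow> bool" where
  "isomorphic G H \<longleftrightarrow>
     (\<exists>f. bij_betw f (verts G) (verts H) \<and>
          (\<forall>u \<in> verts G. \<forall>v \<in> verts G. adjacent G u v \<longleftrightarrow> adjacent H (f u) (f v)))"

definition clique :: "'a sgraph \<Rightarrow> 'a set \<Rightarrow> bool" where
  "clique G K \<longleftrightarrow>
     K \<subseteq> verts G \<and> (\<forall>u \<in> K. \<forall>v \<in> K. u \<noteq> v \<longrightarrow> adjacent G u v)"

definition clique_number :: "'a sgraph \<Rightarrow> nat" where
  "clique_number G = Max (card ` {K. clique G K})"

definition proper_coloring :: "'a sgraph \<Rightarrow> nat \<Rightarrow> ('a \<Rightarrow> nat) \<Rightarrow> bool" where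
  "proper_coloring G n c \<longleftrightarrow>
     (\<forall>v \<in> verts G. c v < n) \<and>
     (\<forall>u \<in> verts G. \<forall>v \<in> verts G. adjacent G u v \<longrightarrow> c u \<noteq> c v)"

definition chromatic_number :: "'a sgraph \<Rightarrow> nat" where
  "chromatic_number G = (LEAST n. \<exists>c. proper_coloring G n c)"

datatype color = Red | Blue

text \<open>
  An edge coloring of \<open>G\<close> is represented by a function on all sets of vertices;
  only its values on \<open>edges G\<close> are ever inspected.
\<close>

definition monochromatic :: "('a set \<Rightarrow> color) \<Rightarrow> 'a sgraph \<Rightarrow> bool" where
  "monochromatic c S \<longleftrightarrow> (\<forall>e \<in> edges S. c e = Red) \<or> (\<forall>e \<in> edges S. c e = Blue)"

text \<open>
  Sequences of graphs are indexed by the positive integers; the entry at index \<open>0\<close> is ignored.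
\<close>

definition ascending :: "(nat \<Rightarrow> 'a sgraph) \<Rightarrow> bool" where
  "ascending H \<longleftrightarrow>
     (\<forall>k\<ge>1. simple_graph (H k)) \<and>
     (\<forall>k\<ge>1. \<exists>S. proper_subgraph S (H (k + 1)) \<and> isomorphic (H k) S)"

definition ramsey_sequence :: "(nat \<Rightarrow> 'a sgraph) \<Rightarrow> bool" where
  "ramsey_sequence H \<longleftrightarrow>
     ascending H \<and>
     (\<forall>k\<ge>1. \<exists>n>k. \<forall>c :: 'a set \<Rightarrow> color.
        \<exists>S. subgraph S (H n) \<and> monochromatic c S \<and> isomorphic (H k) S)"

text \<open>The vertex \<open>[i, j]\<close> is the pair \<open>(i, j)\<close>.\<close>

definition shift_verts :: "nat \<Rightarrow> (int \<times> int) set" where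
  "shift_verts k = {(i, j). 1 \<le> i \<and> i < j \<and> j \<le> 2 ^ k + 1}"

definition shift_graph :: "nat \<Rightarrow> (int \<times> int) sgraph" where
  "shift_graph k =
     \<lparr>verts = shift_verts k,
      edges = {{(i, j), (l, m)} | i j l m.
                 (i, j) \<in> shift_verts k \<and> (l, m) \<in> shift_verts k \<and> (j = l \<or> m = i)}\<rparr>"

end

theory Submission
  imports "HOL-Library.Ramsey" Defs
begin

text \<open>
  The edges of a shift graph correspond to the three-element sets \<open>{x < y < z}\<close> of indices, via
  \<open>{[x, y], [y, z]}\<close>. Ramsey's theorem for triples therefore yields, for any coloring of the edges,
  a large index set all of whose triples give edges of one color, and the shift graph on a finite
  index set depends only on its cardinality. There are no triangles, because a vertex adjacent to
  both \<open>[x, y]\<close> and \<open>[y, z]\<close> would have to be \<open>[z, x]\<close>. For the chromatic number, in a proper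
  coloring the sets of colors of the vertices \<open>[x, _]\<close> differ for different \<open>x\<close>, because the
  color of \<open>[x, y]\<close> cannot occur at \<open>y\<close>; so \<open>n\<close> colors suffice for at most \<open>2\<^sup>n\<close> indices.
\<close>

subsection \<open>Finite sets and linear orders\<close>

lemma finite_linorder_order_isoE:
  fixes A :: "'a::linorder set" and B :: "'b::linorder set"
  assumes "finite A" "finite B" "card A = card B"
  obtains g where "bij_betw g A B" "strict_mono_on A g"
proof -
  define rank where "rank x = card {y \<in> A. y < x}" for x
  define g where "g x = sorted_list_of_set B ! rank x" for x
  have rank_less: "rank x < length (sorted_list_of_set B)" if "x \<in> A" for x
    unfolding rank_def length_sorted_list_of_set \<open>card A = card B\<close>[symmetric]
    using \<open>finite A\<close> that by (intro psubset_card_mono) auto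
  have "rank x < rank y" if "x \<in> A" "x < y" for x y
    unfolding rank_def using \<open>finite A\<close> that by (intro psubset_card_mono) auto
  then have mono: "strict_mono_on A g"
    unfolding g_def
    by (intro strict_mono_onI sorted_wrt_nth_less[OF strict_sorted_list_of_set] rank_less)
  then have inj: "inj_on g A"
    by (rule strict_mono_on_imp_inj_on)
  have "g ` A \<subseteq> B"
    using nth_mem[OF rank_less] \<open>finite B\<close> by (auto simp: g_def)
  then have "g ` A = B"
    using assms inj by (intro card_subset_eq) (auto simp: card_image)
  with inj have "bij_betw g A B"
    by (simp add: bij_betw_def)
  then show thesis
    using mono by (rule that)
qed

lemma partn_lst_replicate_imp_partn:
  assumes partn_lst: "partn_lst {..<N} (replicate (card C) m) r"
    and "finite C" "finite A" "N \<le> card A"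
  shows "partn A m r C"
  unfolding partn_def Ramsey.monochromatic_def
proof
  fix f assume f_coloring: "f \<in> nsets A r \<rightarrow> C"
  obtain e where e_bij: "bij_betw e C {..<card C}"
    using ex_bij_betw_finite_nat[OF \<open>finite C\<close>] by (auto simp: atLeast0LessThan)
  obtain h where h_inj: "h ` {..<N} \<subseteq> A" "inj_on h {..<N}"
    using card_le_inj[of "{..<N}" A] assms by auto
  have "f \<circ> (`) h \<in> nsets {..<N} r \<rightarrow> C"
    using f_coloring h_inj by (intro nsets_compose_image_funcset) auto
  then have "e \<circ> (f \<circ> (`) h) \<in> nsets {..<N} r \<rightarrow> {..<card C}"
    using bij_betw_imp_funcset[OF e_bij] by (auto simp: Pi_iff)
  then obtain i H where "i < card C" and H_nsets: "H \<in> nsets {..<N} m"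
    and e_f_const: "\<And>Y. Y \<in> nsets H r \<Longrightarrow> e (f (h ` Y)) = i"
    by (rule partn_lstE[OF partn_lst]) (auto simp: image_subset_iff)
  then have "i \<in> e ` C"
    using bij_betw_imp_surj_on[OF e_bij] by blast
  then obtain x where "x \<in> C" and e_x: "e x = i"
    by blast
  have inj_H: "inj_on h H"
    using h_inj(2) H_nsets by (auto simp: nsets_def intro: inj_on_subset)
  have image_nsets: "h ` H \<in> nsets A m"
    using h_inj(1) H_nsets inj_H by (auto simp: nsets_def card_image)
  have "f X = x" if X_nsets: "X \<in> nsets (h ` H) r" for X
  proof -
    obtain Y where "Y \<in> nsets H r" "X = h ` Y"
      using nset_image_obtains[OF X_nsets inj_H] .
    then have "e (f X) = e x"
      by (simp add: e_f_const e_x)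
    moreover have "f X \<in> C"
      using f_coloring X_nsets image_nsets nsets_mono[of "h ` H" A r] by (auto simp: nsets_def)
    ultimately show ?thesis
      using e_bij \<open>x \<in> C\<close> by (auto simp: bij_betw_def dest: inj_onD)
  qed
  with image_nsets \<open>x \<in> C\<close> show "\<exists>x\<in>C. \<exists>H\<in>nsets A m. f ` nsets H r \<subseteq> {x}"
    by blast
qed

lemma ramsey_partn:
  assumes "finite C"
  shows "\<exists>N. \<forall>A. finite A \<longrightarrow> N \<le> card A \<longrightarrow> partn A m r C"
proof -
  obtain N :: nat where "partn_lst {..<N} (replicate (card C) m) r"
    using ramsey_full by blast
  from partn_lst_replicate_imp_partn[OF this assms] show ?thesis
    by blast
qed

subsection \<open>Cliques and colorings of graphs\<close>

lemma isomorphic_refl: "isomorphic G G"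
  unfolding isomorphic_def by (rule exI[of _ id]) simp

lemma monochromatic_iff_image_subset: "monochromatic c G \<longleftrightarrow> (\<exists>x. c ` edges G \<subseteq> {x})"
proof
  assume "\<exists>x. c ` edges G \<subseteq> {x}"
  then obtain x where "c ` edges G \<subseteq> {x}" ..
  then show "monochromatic c G"
    by (cases x) (auto simp: monochromatic_def)
qed (auto simp: monochromatic_def)

lemma clique_number_eqI:
  assumes "finite (verts G)" "clique G K" "\<And>L. clique G L \<Longrightarrow> card L \<le> card K"
  shows "clique_number G = card K"
  unfolding clique_number_def
proof (rule Max_eqI)
  have "{L. clique G L} \<subseteq> Pow (verts G)"
    by (auto simp: clique_def)
  then show "finite (card ` {L. clique G L})"
    using assms(1) by (simp add: finite_subset)
qed (use assms in auto)

lemma ex_proper_coloring: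
  assumes "simple_graph G"
  shows "\<exists>n c. proper_coloring G n c"
proof -
  have "finite (verts G)"
    using assms by (simp add: simple_graph_def)
  from finite_imp_inj_to_nat_seg[OF this] obtain c :: "'a \<Rightarrow> nat" and n
    where c_inj: "c ` verts G = {i. i < n}" "inj_on c (verts G)"
    by blast
  have "u \<noteq> v" if "adjacent G u v" for u v
  proof -
    have "card {u, v} = 2"
      using assms that by (auto simp: simple_graph_def adjacent_def)
    then show ?thesis by auto
  qed
  then have "c u \<noteq> c v" if "u \<in> verts G" "v \<in> verts G" "adjacent G u v" for u v
    using c_inj(2) that by (meson inj_onD)
  with c_inj(1) have "proper_coloring G n c"
    unfolding proper_coloring_def by blast
  then show ?thesis by blast
qed

lemma chromatic_number_proper_coloringE:
  assumes "simple_graph G"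
  obtains c where "proper_coloring G (chromatic_number G) c"
proof -
  have "\<exists>c. proper_coloring G (chromatic_number G) c"
    unfolding chromatic_number_def by (rule LeastI_ex) (rule ex_proper_coloring[OF assms])
  then show thesis
    using that by blast
qed

subsection \<open>Shift graphs on linearly ordered sets\<close>

definition shift_graph_on :: "'a::linorder set \<Rightarrow> ('a \<times> 'a) sgraph" where
  "shift_graph_on A =
     \<lparr>verts = {(x, y). x \<in> A \<and> y \<in> A \<and> x < y},
      edges = {{(x, y), (y, z)} | x y z. x \<in> A \<and> y \<in> A \<and> z \<in> A \<and> x < y \<and> y < z}\<rparr>"

lemma verts_shift_graph_on: "verts (shift_graph_on A) = {(x, y). x \<in> A \<and> y \<in> A \<and> x < y}"
  by (simp add: shift_graph_on_def)

lemma adjacent_shift_graph_on: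
  "adjacent (shift_graph_on A) (i, j) (l, m) \<longleftrightarrow>
     (i, j) \<in> verts (shift_graph_on A) \<and> (l, m) \<in> verts (shift_graph_on A) \<and> (j = l \<or> m = i)"
  by (auto simp: adjacent_def shift_graph_on_def doubleton_eq_iff)

lemma finite_verts_shift_graph_on: "finite A \<Longrightarrow> finite (verts (shift_graph_on A))"
  by (rule finite_subset[of _ "A \<times> A"]) (auto simp: verts_shift_graph_on)

lemma simple_graph_shift_graph_on: "finite A \<Longrightarrow> simple_graph (shift_graph_on A)"
  using finite_verts_shift_graph_on[of A]
  by (auto simp: simple_graph_def shift_graph_on_def card_insert_if)

lemma subgraph_shift_graph_on:
  assumes "finite A" "B \<subseteq> A"
  shows "subgraph (shift_graph_on B) (shift_graph_on A)"
proof -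
  have "simple_graph (shift_graph_on B)" "simple_graph (shift_graph_on A)"
    using assms by (auto intro: simple_graph_shift_graph_on finite_subset)
  then show ?thesis
    using assms(2) unfolding subgraph_def shift_graph_on_def by fastforce
qed

lemma isomorphic_shift_graph_on:
  assumes "finite A" "finite B" "card A = card B"
  shows "isomorphic (shift_graph_on A) (shift_graph_on B)"
proof -
  obtain g where g_bij: "bij_betw g A B" and g_mono: "strict_mono_on A g"
    using finite_linorder_order_isoE[OF assms] .
  from g_bij have B_eq: "B = g ` A" and inj: "inj_on g A"
    by (auto simp: bij_betw_def)
  have less_iff: "g x < g y \<longleftrightarrow> x < y" if "x \<in> A" "y \<in> A" for x y
    using strict_mono_on_less[OF g_mono] that by blast
  have "bij_betw (map_prod g g) (verts (shift_graph_on A)) (verts (shift_graph_on B))"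
    unfolding bij_betw_def
  proof
    show "inj_on (map_prod g g) (verts (shift_graph_on A))"
      using map_prod_inj_on[OF inj inj] by (rule inj_on_subset) (auto simp: verts_shift_graph_on)
    show "map_prod g g ` verts (shift_graph_on A) = verts (shift_graph_on B)"
      by (force simp: verts_shift_graph_on B_eq less_iff)
  qed
  moreover have "adjacent (shift_graph_on A) u v \<longleftrightarrow>
      adjacent (shift_graph_on B) (map_prod g g u) (map_prod g g v)"
    if "u \<in> verts (shift_graph_on A)" "v \<in> verts (shift_graph_on A)" for u v
    using that
    by (cases u; cases v)
      (auto simp: adjacent_shift_graph_on verts_shift_graph_on B_eq less_iff inj_on_eq_iff[OF inj])
  ultimately show ?thesis
    unfolding isomorphic_def by blast
qed

subsection \<open>Monochromatic subgraphs\<close>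

definition consecutive_pairs :: "'a::linorder set \<Rightarrow> ('a \<times> 'a) set" where
  "consecutive_pairs X = {(x, y). x \<in> X \<and> y \<in> X \<and> x < y \<and> X \<inter> {x<..<y} = {}}"

lemma consecutive_pairs_triple:
  "x < y \<Longrightarrow> y < z \<Longrightarrow> consecutive_pairs {x, y, z} = {(x, y), (y, z)}"
  by (auto simp: consecutive_pairs_def)

lemma edges_shift_graph_on: "edges (shift_graph_on A) = consecutive_pairs ` nsets A 3"
proof -
  have "consecutive_pairs ` nsets A 3 =
      {consecutive_pairs {x, y, z} | x y z. x \<in> A \<and> y \<in> A \<and> z \<in> A \<and> x < y \<and> y < z}"
    unfolding ordered_nsets_3_eq by blast
  also have "\<dots> = edges (shift_graph_on A)"
    unfolding shift_graph_on_def using consecutive_pairs_triple by fastforce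
  finally show ?thesis ..
qed

lemma ramsey_shift_graph_on:
  "\<exists>N. \<forall>A :: 'a::linorder set. finite A \<longrightarrow> N \<le> card A \<longrightarrow>
     (\<forall>c. \<exists>H\<subseteq>A. card H = m \<and> monochromatic c (shift_graph_on H))"
proof -
  have "finite {Red, Blue}" by simp
  then obtain N where partn: "\<And>A :: 'a set. finite A \<Longrightarrow> N \<le> card A \<Longrightarrow> partn A m 3 {Red, Blue}"
    using ramsey_partn by metis
  have "\<exists>H\<subseteq>A. card H = m \<and> monochromatic c (shift_graph_on H)"
    if large: "finite A" "N \<le> card A" for A :: "'a set" and c
  proof -
    have "c \<circ> consecutive_pairs \<in> nsets A 3 \<rightarrow> {Red, Blue}"
      using color.exhaust by blast
    then obtain x H where H_nsets: "H \<in> nsets A m" and "(c \<circ> consecutive_pairs) ` nsets H 3 \<subseteq> {x}"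
      using partn[OF large] unfolding partn_def Ramsey.monochromatic_def by blast
    then have "monochromatic c (shift_graph_on H)"
      unfolding monochromatic_iff_image_subset edges_shift_graph_on image_comp by blast
    with H_nsets show ?thesis
      by (auto simp: nsets_def)
  qed
  then show ?thesis by blast
qed

subsection \<open>Clique number and chromatic number\<close>

lemma triangle_free_shift_graph_on:
  assumes "adjacent (shift_graph_on A) u v" "adjacent (shift_graph_on A) v w"
  shows "\<not> adjacent (shift_graph_on A) u w"
  using assms
  by (cases u; cases v; cases w) (auto simp: adjacent_shift_graph_on verts_shift_graph_on)

lemma card_clique_shift_graph_on_le:
  assumes "clique (shift_graph_on A) K"
  shows "card K \<le> 2"
proof (rule ccontr)
  assume "\<not> card K \<le> 2"
  then obtain T where "T \<subseteq> K" "card T = 3"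
    using obtain_subset_with_card_n[of 3 K] by auto
  then obtain u v w where "{u, v, w} \<subseteq> K" "u \<noteq> v" "v \<noteq> w" "u \<noteq> w"
    by (auto simp: card_3_iff)
  then have "adjacent (shift_graph_on A) u v" "adjacent (shift_graph_on A) v w"
    "adjacent (shift_graph_on A) u w"
    using assms by (auto simp: clique_def)
  then show False
    using triangle_free_shift_graph_on by blast
qed

lemma clique_number_shift_graph_on:
  assumes "finite A" "3 \<le> card A"
  shows "clique_number (shift_graph_on A) = 2"
proof -
  have "nsets A 3 \<noteq> {}"
    using assms by (simp add: nsets_eq_empty_iff)
  then obtain x y z where "x \<in> A" "y \<in> A" "z \<in> A" "x < y" "y < z"
    unfolding ordered_nsets_3_eq by blast
  then have "clique (shift_graph_on A) {(x, y), (y, z)}" "card {(x, y), (y, z)} = 2"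
    by (auto simp: clique_def adjacent_shift_graph_on verts_shift_graph_on card_insert_if)
  then show ?thesis
    using clique_number_eqI finite_verts_shift_graph_on[OF \<open>finite A\<close>]
      card_clique_shift_graph_on_le by metis
qed

lemma proper_coloring_shift_graph_on_imp_card_le:
  assumes coloring: "proper_coloring (shift_graph_on A) n c"
  shows "card A \<le> 2 ^ n"
proof -
  define colors_from where "colors_from x = {c (x, y) | y. y \<in> A \<and> x < y}" for x
  have "colors_from x \<noteq> colors_from y" if "x \<in> A" "y \<in> A" "x < y" for x y
  proof
    assume "colors_from x = colors_from y"
    moreover have "c (x, y) \<in> colors_from x"
      using that by (auto simp: colors_from_def)
    ultimately obtain z where "z \<in> A" "y < z" and z_color: "c (x, y) = c (y, z)"
      by (auto simp: colors_from_def)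
    then have "adjacent (shift_graph_on A) (x, y) (y, z)"
      using that by (simp add: adjacent_shift_graph_on verts_shift_graph_on)
    then show False
      using coloring z_color by (auto simp: proper_coloring_def adjacent_shift_graph_on)
  qed
  then have "inj_on colors_from A"
    by (intro linorder_inj_onI) auto
  moreover have "colors_from ` A \<subseteq> Pow {..<n}"
    using coloring by (auto simp: colors_from_def proper_coloring_def verts_shift_graph_on)
  ultimately have "card A \<le> card (Pow {..<n})"
    by (rule card_inj_on_le) simp
  then show ?thesis
    by (simp add: card_Pow)
qed

lemma card_le_power_chromatic_number_shift_graph_on:
  assumes "finite A"
  shows "card A \<le> 2 ^ chromatic_number (shift_graph_on A)"
  using chromatic_number_proper_coloringE[OF simple_graph_shift_graph_on[OF assms]]
    proper_coloring_shift_graph_on_imp_card_le by metis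

subsection \<open>The sequence of shift graphs\<close>

lemma shift_graph_eq_shift_graph_on: "shift_graph k = shift_graph_on {1..2 ^ k + 1}"
proof -
  have "edges (shift_graph k) = edges (shift_graph_on {1..2 ^ k + 1})"
  proof (intro equalityI subsetI)
    fix e assume "e \<in> edges (shift_graph k)"
    then obtain i j l m where edge: "e = {(i, j), (l, m)}" "j = l \<or> m = i"
      and "(i, j) \<in> shift_verts k" "(l, m) \<in> shift_verts k"
      by (auto simp: shift_graph_def)
    then have "adjacent (shift_graph_on {1..2 ^ k + 1}) (i, j) (l, m)"
      by (simp add: adjacent_shift_graph_on verts_shift_graph_on shift_verts_def)
    with edge show "e \<in> edges (shift_graph_on {1..2 ^ k + 1})"
      by (simp add: adjacent_def)
  qed (force simp: shift_graph_def shift_graph_on_def shift_verts_def)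
  moreover have "verts (shift_graph k) = verts (shift_graph_on {1..2 ^ k + 1})"
    by (auto simp: shift_graph_def shift_verts_def verts_shift_graph_on)
  ultimately show ?thesis
    by simp
qed

lemma card_shift_graph_indices: "card {1..2 ^ k + 1 :: int} = 2 ^ k + 1"
  by (simp add: nat_add_distrib nat_power_eq)

lemma ascending_shift_graph: "ascending shift_graph"
  unfolding ascending_def
proof (intro conjI allI impI)
  fix k :: nat
  show "simple_graph (shift_graph k)"
    by (simp add: shift_graph_eq_shift_graph_on simple_graph_shift_graph_on)
  have "subgraph (shift_graph k) (shift_graph (k + 1))"
    unfolding shift_graph_eq_shift_graph_on by (rule subgraph_shift_graph_on) auto
  moreover have "(1, 2 ^ (k + 1) + 1) \<in> verts (shift_graph (k + 1)) - verts (shift_graph k)"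
    by (simp add: shift_graph_eq_shift_graph_on verts_shift_graph_on)
  ultimately have "proper_subgraph (shift_graph k) (shift_graph (k + 1))"
    by (auto simp: proper_subgraph_def)
  then show "\<exists>S. proper_subgraph S (shift_graph (k + 1)) \<and> isomorphic (shift_graph k) S"
    using isomorphic_refl by blast
qed

lemma ramsey_sequence_shift_graph: "ramsey_sequence shift_graph"
  unfolding ramsey_sequence_def
proof (intro conjI allI impI ascending_shift_graph)
  fix k :: nat
  obtain N where ramsey: "\<And>(A :: int set) c. finite A \<Longrightarrow> N \<le> card A \<Longrightarrow>
      \<exists>H\<subseteq>A. card H = 2 ^ k + 1 \<and> monochromatic c (shift_graph_on H)"
    using ramsey_shift_graph_on by metis
  define n where "n = max (k + 1) N"
  let ?A = "{1..2 ^ n + 1 :: int}"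
  have "N \<le> n" by (simp add: n_def)
  also have "n < 2 ^ n" by (rule less_exp)
  finally have "N \<le> card ?A"
    unfolding card_shift_graph_indices by simp
  have "\<exists>S. subgraph S (shift_graph n) \<and> monochromatic c S \<and> isomorphic (shift_graph k) S" for c
  proof -
    obtain H where "H \<subseteq> ?A" and card_H: "card H = 2 ^ k + 1"
      and "monochromatic c (shift_graph_on H)"
      using ramsey[OF _ \<open>N \<le> card ?A\<close>] by auto
    moreover have "subgraph (shift_graph_on H) (shift_graph n)"
      unfolding shift_graph_eq_shift_graph_on using \<open>H \<subseteq> ?A\<close> by (intro subgraph_shift_graph_on) auto
    moreover have "card {1..2 ^ k + 1 :: int} = card H"
      by (simp only: card_shift_graph_indices card_H)
    then have "isomorphic (shift_graph k) (shift_graph_on H)"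
      unfolding shift_graph_eq_shift_graph_on
      using finite_subset[OF \<open>H \<subseteq> ?A\<close>] by (intro isomorphic_shift_graph_on) auto
    ultimately show ?thesis by blast
  qed
  moreover have "k < n" by (simp add: n_def)
  ultimately show "\<exists>n>k. \<forall>c. \<exists>S. subgraph S (shift_graph n) \<and> monochromatic c S \<and>
      isomorphic (shift_graph k) S"
    by blast
qed

lemma clique_number_shift_graph:
  assumes "1 \<le> k"
  shows "clique_number (shift_graph k) = 2"
proof -
  have "(2 :: nat) ^ 1 \<le> 2 ^ k"
    using assms by (intro power_increasing) auto
  then have "3 \<le> card {1..2 ^ k + 1 :: int}"
    unfolding card_shift_graph_indices by simp
  then show ?thesis
    unfolding shift_graph_eq_shift_graph_on
    by (intro clique_number_shift_graph_on) simp_all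
qed

lemma less_chromatic_number_shift_graph: "k < chromatic_number (shift_graph k)"
proof -
  have "2 ^ k < card {1..2 ^ k + 1 :: int}"
    by (simp add: card_shift_graph_indices)
  also have "\<dots> \<le> 2 ^ chromatic_number (shift_graph k)"
    unfolding shift_graph_eq_shift_graph_on
    by (rule card_le_power_chromatic_number_shift_graph_on) simp
  finally show ?thesis by simp
qed

theorem theorem4:
  shows "ramsey_sequence shift_graph \<and>
         ascending shift_graph \<and>
         (\<forall>k\<ge>1. clique_number (shift_graph k) = 2) \<and>
         filterlim (\<lambda>k. chromatic_number (shift_graph k)) at_top sequentially"
proof (intro conjI allI impI)
  show "ramsey_sequence shift_graph"
    by (rule ramsey_sequence_shift_graph)
  show "ascending shift_graph"
    by (rule ascending_shift_graph)
  show "clique_number (shift_graph k) = 2" if "1 \<le> k" for k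
    using that by (rule clique_number_shift_graph)
  show "filterlim (\<lambda>k. chromatic_number (shift_graph k)) at_top sequentially"
    by (rule filterlim_at_top_mono[OF filterlim_ident])
      (simp add: less_imp_le less_chromatic_number_shift_graph)
qed

end
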